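(* In a lifelong Markov decision process (L-MDP), let $\mathcal A$ be the set of actions available in $\mathcal M_k$, and let $\epsilon_k$ denote the maximum distance in the underlying structure of the closest pair of available actions, i.e., $$\epsilon_k := \sup_{a_i\in\mathcal A}\ \inf_{a_j\in\mathcal A}\ \lVert e_i-e_j\rVert_1 ,$$ where $e_i,e_j\in\mathcal E$ are the underlying structures of $a_i,a_j$ (that is, $a_i=\phi(e_i)$, $a_j=\phi(e_j)$). Let $\pi_k^*$ be an optimal policy for $\mathcal M_k$ (optimal when considering only policies that use actions available in $\mathcal M_k$), and let $\mu^*$ be a hypothetical policy that acts optimally given access to all possible actions. Then $$v^{\mu^*}(s_0)-v^{\pi_k^*}(s_0)\ \le\ \frac{\gamma\,\rho\,\epsilon_k}{(1-\gamma)^2}\,R_{\max},$$ where $s_0$ is the initial state.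
   Context: **L-MDP.** The set of all possible actions (those available now and those that may become available later) is viewed as a space $\mathcal E\subseteq\mathbb R^d$ of underlying structures. An L-MDP is $\mathscr L=(\mathcal M_0,\mathcal E,\mathcal D,\mathcal F)$, extending a base MDP $\mathcal M_0=(\mathcal S,\mathcal A,\mathcal P,\mathcal R,\gamma,d_0)$ with state set $\mathcal S$ (taken finite for notational ease), empty action set $\mathcal A=\emptyset$, transition function $\mathcal P$, discount $\gamma\in[0,1)$ and initial-state distribution $d_0$. The reward function depends only on the state: $\mathcal R(s)=\mathbf E[R_t\mid S_t=s]$, where $R_t\in[-R_{\max},R_{\max}]$ for some finite $R_{\max}$. At the start of episode $\tau$, new actions are added with probability $\mathcal F(\tau)$; when they are added, the nonempty set added is drawn from a distribution $\mathcal D_\tau$ over subsets of $\mathcal E$, and $\mathcal D=\{\mathcal D_\tau\}$. The index $k$ counts the number of times the action set has changed. If $u_k\subseteq\mathcal E$ is the set added at the $k$-th change, the agent observes the discrete actions $\mathcal A_k=\{\phi(e_i): e_i\in u_k\}$, where $\phi$ is a map relating underlying structures to observed discrete actions. The MDP $\mathcal M_k$ is the same as $\mathcal M_{k-1}$ except that its action set $\mathcal A$ is the union of the action set of $\mathcal M_{k-1}$ and $\mathcal A_k$. **Transitions.** $\mathcal P(s,a,s')$ denotes the transition probability $P(s'\mid s,e)$ from $s$ to $s'$, where $a=\phi(e)$. **$\rho$-Lipschitz condition.** The transition probabilities are assumed $\rho$-Lipschitz in the structure of actions: there is $\rho>0$ such that for all $s,s'\in\mathcal S$ and $e_i,e_j\in\mathcal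 E$, $$\lVert P(s'\mid s,e_i)-P(s'\mid s,e_j)\rVert_1\le\rho\,\lVert e_i-e_j\rVert_1 .$$ **Values.** The state value function of a policy $\pi$ is $v^{\pi}(s)=\mathbf E\big[\sum_{t=0}^\infty\gamma^tR_t\mid s,\pi\big]$, the expected discounted sum of rewards starting from state $s$ and following $\pi$; optimal policies maximize it.
   Formalization: In the formal statement the outer supremum in ε_k ranges over all possible actions φ(e), e ∈ E, and only the infimum over actions available in M_k; with available actions in both places ε_k is always 0 and the claimed bound is false. *)

theory Defs
  imports "HOL-Probability.Probability"
begin

section \<open>Markov decision processes\<close>

text \<open>The reward observed in state \<open>s\<close> is a random variable with law \<open>rewards M s\<close>; the reward
  function of the MDP is its mean.  The state set is the whole (finite) type of states.  The
  transition function is total on the type of actions; only its values on actions that a policy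
  may use are relevant.\<close>

record ('s, 'a) mdp =
  actions :: "'a set"
  trans :: "'s \<Rightarrow> 'a \<Rightarrow> 's pmf"
  rewards :: "'s \<Rightarrow> real measure"
  discount :: real
  init :: "'s pmf"

definition mdp :: "real \<Rightarrow> ('s::finite, 'a) mdp \<Rightarrow> bool" where
  "mdp Rmax M \<longleftrightarrow> 0 \<le> discount M \<and> discount M < 1 \<and>
     (\<forall>s. prob_space (rewards M s) \<and> sets (rewards M s) = sets borel \<and>
          (AE r in rewards M s. r \<in> {- Rmax..Rmax}))"

definition policies :: "('s, 'a) mdp \<Rightarrow> ('s \<Rightarrow> 'a pmf) set" where
  "policies M = {\<pi>. \<forall>s. set_pmf (\<pi> s) \<subseteq> actions M}"

text \<open>One time step is a triple of a state, an action and a reward.\<close>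

definition step_space :: "('s \<times> 'a \<times> real) measure" where
  "step_space = count_space UNIV \<Otimes>\<^sub>M (count_space UNIV \<Otimes>\<^sub>M borel)"

definition step_law ::
    "('s, 'a) mdp \<Rightarrow> ('s \<Rightarrow> 'a pmf) \<Rightarrow> 's \<Rightarrow> ('s \<times> 'a \<times> real) measure" where
  "step_law M \<pi> s = return (count_space UNIV) s \<Otimes>\<^sub>M (measure_pmf (\<pi> s) \<Otimes>\<^sub>M rewards M s)"

text \<open>The law of step \<open>t\<close> given the steps \<open>0, \<dots>, t - 1\<close>, when the process starts in \<open>s\<close>.\<close>

definition step_kernel ::
    "('s, 'a) mdp \<Rightarrow> ('s \<Rightarrow> 'a pmf) \<Rightarrow> 's \<Rightarrow> nat \<Rightarrow> (nat \<Rightarrow> 's \<times> 'a \<times> real) \<Rightarrow> ('s \<times> 'a \<times> real) measure"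
  where
  "step_kernel M \<pi> s t h =
     (case t of
        0 \<Rightarrow> step_law M \<pi> s
      | Suc t' \<Rightarrow> (case h t' of (s', a, _) \<Rightarrow> measure_pmf (trans M s' a) \<bind> step_law M \<pi>))"

text \<open>The law of the whole trajectory, by the Ionescu-Tulcea theorem.\<close>

definition trajectory ::
    "('s, 'a) mdp \<Rightarrow> ('s \<Rightarrow> 'a pmf) \<Rightarrow> 's \<Rightarrow> (nat \<Rightarrow> 's \<times> 'a \<times> real) measure" where
  "trajectory M \<pi> s =
     projective_family.lim UNIV
       (Ionescu_Tulcea.CI (step_kernel M \<pi> s) (\<lambda>_. step_space)) (\<lambda>_. step_space)"

definition reward_at :: "nat \<Rightarrow> (nat \<Rightarrow> 's \<times> 'a \<times> real) \<Rightarrow> real" where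
  "reward_at t \<omega> = snd (snd (\<omega> t))"

definition state_value :: "('s, 'a) mdp \<Rightarrow> ('s \<Rightarrow> 'a pmf) \<Rightarrow> 's \<Rightarrow> real" where
  "state_value M \<pi> s = (\<integral>\<omega>. (\<Sum>t. discount M ^ t * reward_at t \<omega>) \<partial>trajectory M \<pi> s)"

definition optimal_policy :: "('s, 'a) mdp \<Rightarrow> ('s \<Rightarrow> 'a pmf) \<Rightarrow> bool" where
  "optimal_policy M \<pi> \<longleftrightarrow>
     \<pi> \<in> policies M \<and> (\<forall>\<pi>' \<in> policies M. \<forall>s. state_value M \<pi>' s \<le> state_value M \<pi> s)"

text \<open>The conditions under which the trajectory measure exists.\<close>

lemma space_step_space [simp]: "space step_space = UNIV"
  by (simp add: step_space_def space_pair_measure)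

lemma step_law_subprob:
  assumes "mdp Rmax M"
  shows "step_law M \<pi> s \<in> space (subprob_algebra step_space)" "prob_space (step_law M \<pi> s)"
proof -
  interpret R: prob_space "rewards M s"
    using assms by (simp add: mdp_def)
  interpret A: pair_prob_space "measure_pmf (\<pi> s)" "rewards M s" ..
  interpret S: prob_space "return (count_space UNIV) s"
    by (rule prob_space_return) simp
  interpret T: pair_prob_space "return (count_space UNIV) s" "measure_pmf (\<pi> s) \<Otimes>\<^sub>M rewards M s" ..
  show *: "prob_space (step_law M \<pi> s)"
    unfolding step_law_def by (rule T.prob_space_axioms)
  have "sets (step_law M \<pi> s) = sets step_space"
    unfolding step_law_def step_space_def using assms
    by (intro sets_pair_measure_cong) (auto simp: mdp_def)
  then show "step_law M \<pi> s \<in> space (subprob_algebra step_space)"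
    using * by (simp add: space_subprob_algebra prob_space_imp_subprob_space)
qed

lemma Ionescu_Tulcea_step_kernel:
  fixes M :: "('s::finite, 'a) mdp"
  assumes "mdp Rmax M"
  shows "Ionescu_Tulcea (step_kernel M \<pi> s) (\<lambda>_. step_space)"
proof (rule Ionescu_Tulcea.intro)
  have law: "step_law M \<pi> \<in> measurable (measure_pmf p) (subprob_algebra step_space)" for p
    using step_law_subprob(1)[OF assms] by (auto simp: measurable_def)
  define g where "g = (\<lambda>s' a. measure_pmf (trans M s' a) \<bind> step_law M \<pi>)"
  have g: "g s' a \<in> space (subprob_algebra step_space)" "prob_space (g s' a)" for s' a
  proof -
    show p: "prob_space (g s' a)"
      unfolding g_def using step_law_subprob(2)[OF assms]
      by (intro prob_space.prob_space_bind[OF measure_pmf.prob_space_axioms _ law]) auto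
    have "sets (g s' a) = sets step_space"
      unfolding g_def
      by (rule sets_bind) (use step_law_subprob(1)[OF assms] in \<open>auto simp: space_subprob_algebra\<close>)
    then show "g s' a \<in> space (subprob_algebra step_space)"
      using p by (simp add: space_subprob_algebra prob_space_imp_subprob_space)
  qed
  have meas_g: "(\<lambda>x. case x of (s', a, r) \<Rightarrow> g s' a)
      \<in> measurable step_space (subprob_algebra step_space)"
  proof -
    have "(\<lambda>x :: 's \<times> 'a \<times> real. fst (snd x)) \<in> measurable step_space (count_space UNIV)"
      unfolding step_space_def by measurable
    moreover have "g s' \<in> measurable (count_space UNIV) (subprob_algebra step_space)" for s'
      using g(1) by (auto simp: measurable_def)
    ultimately have 1: "(\<lambda>x :: 's \<times> 'a \<times> real. g s' (fst (snd x)))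
        \<in> measurable step_space (subprob_algebra step_space)" for s'
      by (rule measurable_compose)
    have 2: "(fst :: 's \<times> 'a \<times> real \<Rightarrow> 's) \<in> measurable step_space (count_space UNIV)"
      unfolding step_space_def by (rule measurable_fst)
    have "(\<lambda>x. g (fst x) (fst (snd x))) \<in> measurable step_space (subprob_algebra step_space)"
      by (rule measurable_compose_countable[OF 1 2])
    then show ?thesis
      by (simp add: case_prod_beta')
  qed
  show "step_kernel M \<pi> s t \<in> measurable (Pi\<^sub>M {0..<t} (\<lambda>_. step_space)) (subprob_algebra step_space)" for t
  proof (cases t)
    case 0
    then show ?thesis
      using step_law_subprob(1)[OF assms] by (auto simp: step_kernel_def[abs_def])
  next
    case (Suc t')
    have "(\<lambda>h. h t') \<in> measurable (Pi\<^sub>M {0..<t} (\<lambda>_. step_space)) step_space"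
      using Suc by (intro measurable_component_singleton) auto
    from measurable_compose[OF this meas_g] show ?thesis
      using Suc by (simp add: step_kernel_def[abs_def] g_def)
  qed
  show "prob_space (step_kernel M \<pi> s t h)" if "h \<in> space (Pi\<^sub>M {0..<t} (\<lambda>_. step_space))" for t h
    using g(2) step_law_subprob(2)[OF assms]
    by (auto simp: step_kernel_def g_def split: nat.split prod.split)
qed

section \<open>Lifelong Markov decision processes\<close>

definition l1_norm :: "real ^ 'd \<Rightarrow> real" where
  "l1_norm x = (\<Sum>i\<in>UNIV. \<bar>x $ i\<bar>)"

definition l1_dist_pmf :: "'s::finite pmf \<Rightarrow> 's pmf \<Rightarrow> real" where
  "l1_dist_pmf p q = (\<Sum>s\<in>UNIV. \<bar>pmf p s - pmf q s\<bar>)"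

text \<open>\<open>add_prob L \<tau>\<close> is the probability that actions are added at the start of episode \<open>\<tau>\<close>, and
  \<open>add_law L \<tau>\<close> the distribution of the set that is then added.\<close>

record ('s, 'a, 'd) lmdp =
  base :: "('s, 'a) mdp"
  structs :: "(real ^ 'd) set"
  add_law :: "nat \<Rightarrow> (real ^ 'd) set measure"
  add_prob :: "nat \<Rightarrow> real"
  observe :: "real ^ 'd \<Rightarrow> 'a"

definition lmdp :: "real \<Rightarrow> ('s::finite, 'a, 'd::finite) lmdp \<Rightarrow> bool" where
  "lmdp Rmax L \<longleftrightarrow> mdp Rmax (base L) \<and> actions (base L) = {} \<and>
     (\<forall>\<tau>. add_prob L \<tau> \<in> {0..1} \<and> prob_space (add_law L \<tau>) \<and>
          space (add_law L \<tau>) \<subseteq> Pow (structs L) - {{}})"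

definition struct_trans :: "('s, 'a, 'd::finite) lmdp \<Rightarrow> 's \<Rightarrow> real ^ 'd \<Rightarrow> 's pmf" where
  "struct_trans L s e = trans (base L) s (observe L e)"

text \<open>The L1 norm on the left is that of the whole distribution over successor states, not of a
  single probability.\<close>

definition lipschitz_trans :: "real \<Rightarrow> ('s::finite, 'a, 'd::finite) lmdp \<Rightarrow> bool" where
  "lipschitz_trans \<rho> L \<longleftrightarrow> 0 < \<rho> \<and>
     (\<forall>s. \<forall>e \<in> structs L. \<forall>e' \<in> structs L.
        l1_dist_pmf (struct_trans L s e) (struct_trans L s e') \<le> \<rho> * l1_norm (e - e'))"

text \<open>A realisation of the first \<open>k\<close> changes: the \<open>j\<close>-th change happens at the start of episode
  \<open>\<tau> j\<close> and adds the set \<open>u j\<close>, for \<open>j = 1, \<dots>, k\<close>.\<close>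

definition changes ::
    "('s, 'a, 'd::finite) lmdp \<Rightarrow> nat \<Rightarrow> (nat \<Rightarrow> nat) \<Rightarrow> (nat \<Rightarrow> (real ^ 'd) set) \<Rightarrow> bool" where
  "changes L k \<tau> u \<longleftrightarrow> strict_mono_on {1..k} \<tau> \<and>
     (\<forall>j \<in> {1..k}. 0 < add_prob L (\<tau> j) \<and> u j \<in> space (add_law L (\<tau> j)))"

primrec mdp_at ::
    "('s, 'a, 'd::finite) lmdp \<Rightarrow> (nat \<Rightarrow> (real ^ 'd) set) \<Rightarrow> nat \<Rightarrow> ('s, 'a) mdp" where
  "mdp_at L u 0 = base L"
| "mdp_at L u (Suc k) =
     (mdp_at L u k)\<lparr>actions := actions (mdp_at L u k) \<union> observe L ` u (Suc k)\<rparr>"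

definition full_mdp :: "('s, 'a, 'd::finite) lmdp \<Rightarrow> ('s, 'a) mdp" where
  "full_mdp L = (base L)\<lparr>actions := observe L ` structs L\<rparr>"

definition structs_of :: "('s, 'a, 'd::finite) lmdp \<Rightarrow> 'a set \<Rightarrow> (real ^ 'd) set" where
  "structs_of L A = {e \<in> structs L. observe L e \<in> A}"

text \<open>The outer supremum ranges over all possible actions, the infimum over the available ones:
  with the available actions in both places the infimum would be attained at the action itself
  and the gap would always be 0.  The value is infinite if the structure space is not within a
  bounded distance of the available actions.\<close>

definition action_gap :: "('s, 'a, 'd::finite) lmdp \<Rightarrow> ('s, 'a) mdp \<Rightarrow> ereal" where
  "action_gap L M =
     (SUP e \<in> structs_of L (actions (full_mdp L)).
        INF e' \<in> structs_of L (actions M). ereal (l1_norm (e - e')))"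

end

theory Submission
  imports Defs
begin

text \<open>Given \<open>\<delta> > 0\<close>, let an agent restricted to the available actions imitate \<open>\<mu>\<close>: it samples an
  action from \<open>\<mu>\<close> and plays an available one whose structure is within \<open>\<epsilon>\<^sub>k + \<delta>\<close> of it.  Subtract
  the Bellman equations of the two policies.  In each state the values differ by at most \<open>\<gamma>\<close> times
  the effect of the change of transition law, at most \<open>\<rho> (\<epsilon>\<^sub>k + \<delta>) Rmax / (1 - \<gamma>)\<close>, plus \<open>\<gamma>\<close> times
  the largest difference \<open>D\<close> of the two value functions.  Taking the maximum over the states and
  solving for \<open>D\<close> gives the bound, as \<open>\<delta>\<close> tends to 0.  Only policy evaluation is used, never
  Bellman optimality.  The Bellman equation comes from the marginals of the Ionescu-Tulcea
  measure.\<close>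

section \<open>Marginals of the trajectory\<close>

text \<open>\<open>C 0 (Suc t)\<close> is \<open>C 0 t\<close> followed by \<open>eP t\<close>, and
  \<open>eP t\<close> writes a sample of \<open>P t\<close> into coordinate \<open>t\<close> of the
  history. Reading off that coordinate undoes the writing and leaves the kernel itself.\<close>

lemma (in Ionescu_Tulcea) distr_C_last:
  "distr (C 0 (Suc t) (\<lambda>_. undefined)) (M t) (\<lambda>\<omega>. \<omega> t) = C 0 t (\<lambda>_. undefined) \<bind> P t"
proof -
  let ?u = "\<lambda>_. undefined"
  have u: "?u \<in> space (Pi\<^sub>M {0..<0} M)" by simp
  have eP: "eP t \<in> measurable (C 0 t ?u) (subprob_algebra (Pi\<^sub>M {0..<Suc t} M))"
    using measurable_eP[of t] by (simp add: measurable_cong_sets[OF sets_C[OF u] refl])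
  have last: "(\<lambda>\<omega>. \<omega> t) \<in> measurable (Pi\<^sub>M {0..<Suc t} M) (M t)"
    by (rule measurable_component_singleton) simp
  have "distr (C 0 (Suc t) ?u) (M t) (\<lambda>\<omega>. \<omega> t) =
      C 0 t ?u \<bind> (\<lambda>\<omega>. distr (eP t \<omega>) (M t) (\<lambda>\<omega>. \<omega> t))"
    using distr_bind[OF eP _ last] prob_space.not_empty[OF prob_space_C[OF u]] by simp
  also have "\<dots> = C 0 t ?u \<bind> P t"
  proof (rule bind_cong[OF refl])
    fix \<omega> assume "\<omega> \<in> space (C 0 t ?u)"
    then have \<omega>: "\<omega> \<in> space (Pi\<^sub>M {0..<t} M)"
      using space_C[OF u, of t] by simp
    have upd: "fun_upd \<omega> t \<in> measurable (P t \<omega>) (Pi\<^sub>M {0..<Suc t} M)"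
      using \<omega> by (intro measurable_fun_upd[where J="{0..<t}"]) (auto simp: sets_P measurable_ident_sets)
    have "distr (eP t \<omega>) (M t) (\<lambda>\<omega>. \<omega> t) = distr (P t \<omega>) (M t) (\<lambda>x. x)"
      unfolding eP_def using distr_distr[OF last upd] by (simp add: comp_def)
    also have "\<dots> = P t \<omega>"
      using sets_P[OF \<omega>] by (simp add: distr_id2)
    finally show "distr (eP t \<omega>) (M t) (\<lambda>\<omega>. \<omega> t) = P t \<omega>" .
  qed
  finally show ?thesis .
qed

text \<open>Coordinate \<open>t\<close> factors through the restriction to the first
  \<open>t + 1\<close> coordinates, so the projective limit can be exchanged for its
  finite-dimensional marginal, which is built from \<open>C\<close>.\<close>

lemma (in Ionescu_Tulcea) distr_lim_component:
  "distr PF.lim (M t) (\<lambda>\<omega>. \<omega> t) = C 0 t (\<lambda>_. undefined) \<bind> P t"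
proof -
  let ?J = "{0..<Suc t}" and ?u = "\<lambda>_. undefined"
  have last: "(\<lambda>\<omega>. \<omega> t) \<in> measurable (Pi\<^sub>M ?J M) (M t)"
    by (rule measurable_component_singleton) simp
  have restr: "(\<lambda>\<omega>. restrict \<omega> ?J) \<in> measurable (Pi\<^sub>M UNIV M) (Pi\<^sub>M ?J M)"
    "(\<lambda>\<omega>. restrict \<omega> ?J) \<in> measurable (Pi\<^sub>M ?J M) (Pi\<^sub>M ?J M)"
    by (auto intro!: measurable_restrict measurable_component_singleton)
  \<comment> \<open>\<open>CI ?J\<close> is the restriction to \<open>?J\<close> of
    \<open>C 0 (up_to ?J)\<close>, where \<open>up_to ?J\<close> is the least strict upper bound of
    \<open>?J\<close>. For an initial segment the restriction loses nothing.\<close>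
  have up: "up_to ?J = Suc t"
    by (rule antisym) (auto simp: up_to_iff Suc_le_eq up_to_less)
  have "distr PF.lim (M t) (\<lambda>\<omega>. \<omega> t) =
      distr (distr PF.lim (Pi\<^sub>M ?J M) (\<lambda>\<omega>. restrict \<omega> ?J)) (M t) (\<lambda>\<omega>. \<omega> t)"
    using restr(1) by (subst distr_distr[OF last]) (auto simp: comp_def measurable_cong_sets[OF PF.sets_lim refl])
  also have "\<dots> = distr (CI ?J) (M t) (\<lambda>\<omega>. \<omega> t)"
    by (subst distr_lim) auto
  also have "\<dots> = distr (C 0 (Suc t) ?u) (M t) (\<lambda>\<omega>. \<omega> t)"
    unfolding CI_def up using restr(2) sets_C[of ?u 0 "Suc t"]
    by (subst distr_distr[OF last]) (auto simp: comp_def cong: measurable_cong_sets)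
  finally show ?thesis
    by (simp only: distr_C_last)
qed

section \<open>Marginals of a single step\<close>

lemma distr_pair_snd:
  assumes "prob_space M" "prob_space N"
  shows "distr (M \<Otimes>\<^sub>M N) N snd = N"
proof (rule measure_eqI)
  interpret M: prob_space M by fact
  interpret N: prob_space N by fact
  fix A assume "A \<in> sets (distr (M \<Otimes>\<^sub>M N) N snd)"
  then have A: "A \<in> sets N" by simp
  have "snd -` A \<inter> space (M \<Otimes>\<^sub>M N) = space M \<times> A"
    using sets.sets_into_space[OF A] by (auto simp: space_pair_measure)
  with A show "emeasure (distr (M \<Otimes>\<^sub>M N) N snd) A = emeasure N A"
    by (simp add: emeasure_distr N.emeasure_pair_measure_Times M.emeasure_space_1)
qed simp

lemma measurable_step_law:
  assumes "mdp Rmax M"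
  shows "step_law M \<pi> \<in> measurable (measure_pmf p) (subprob_algebra step_space)"
  using step_law_subprob(1)[OF assms] by (auto simp: measurable_def)

lemma sets_step_law: "mdp Rmax M \<Longrightarrow> sets (step_law M \<pi> s) = sets step_space"
  using step_law_subprob(1) by (fastforce simp: space_subprob_algebra)

lemma measurable_step_components:
  "(fst :: 's \<times> 'a \<times> real \<Rightarrow> 's) \<in> measurable step_space (count_space UNIV)"
  "(\<lambda>x :: 's \<times> 'a \<times> real. fst (snd x)) \<in> measurable step_space (count_space UNIV)"
  "(\<lambda>x :: 's \<times> 'a \<times> real. snd (snd x)) \<in> measurable step_space borel"
  unfolding step_space_def by measurable

text \<open>The three entries are independent by construction. The state entry equals
  \<open>s\<close> only almost surely, so substituting \<open>s\<close> for it inside a bind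
  requires an almost-everywhere congruence.\<close>

lemma
  assumes "mdp Rmax M"
  shows AE_step_law_state: "AE x in step_law M \<pi> s. fst x = s"
    and distr_step_law_action:
      "distr (step_law M \<pi> s) (count_space UNIV) (\<lambda>x. fst (snd x)) = measure_pmf (\<pi> s)"
    and distr_step_law_reward:
      "distr (step_law M \<pi> s) borel (\<lambda>x. snd (snd x)) = rewards M s"
proof -
  interpret R: prob_space "rewards M s"
    using assms by (simp add: mdp_def)
  have sets_R: "sets (rewards M s) = sets borel"
    using assms by (simp add: mdp_def)
  interpret A: pair_prob_space "measure_pmf (\<pi> s)" "rewards M s" ..
  interpret S: prob_space "return (count_space UNIV) s"
    by (rule prob_space_return) simp
  let ?S = "return (count_space UNIV) s" and ?N = "measure_pmf (\<pi> s) \<Otimes>\<^sub>M rewards M s"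
  have "distr (?S \<Otimes>\<^sub>M ?N) ?S fst = ?S"
    by (rule A.distr_pair_fst)
  moreover have "AE x in ?S. x = s"
    by (subst AE_return) auto
  ultimately have "AE x in distr (?S \<Otimes>\<^sub>M ?N) ?S fst. x = s" by (simp only:)
  then show "AE x in step_law M \<pi> s. fst x = s"
    unfolding step_law_def by (rule AE_distrD[OF measurable_fst])
  have snd: "distr (?S \<Otimes>\<^sub>M ?N) ?N snd = ?N"
    by (intro distr_pair_snd S.prob_space_axioms A.prob_space_axioms)
  have f: "fst \<in> measurable ?N (measure_pmf (\<pi> s))" and g: "snd \<in> measurable ?N (rewards M s)"
    by auto
  have "distr (?S \<Otimes>\<^sub>M ?N) (measure_pmf (\<pi> s)) (\<lambda>x. fst (snd x)) = measure_pmf (\<pi> s)"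
    using distr_distr[OF f measurable_snd, of ?S] R.distr_pair_fst[of "measure_pmf (\<pi> s)"]
    by (simp add: snd comp_def)
  moreover have "distr (?S \<Otimes>\<^sub>M ?N) (count_space UNIV) (\<lambda>x. fst (snd x)) =
      distr (?S \<Otimes>\<^sub>M ?N) (measure_pmf (\<pi> s)) (\<lambda>x. fst (snd x))"
    by (rule distr_cong) auto
  ultimately show "distr (step_law M \<pi> s) (count_space UNIV) (\<lambda>x. fst (snd x)) = measure_pmf (\<pi> s)"
    unfolding step_law_def by simp
  have "distr (?S \<Otimes>\<^sub>M ?N) (rewards M s) (\<lambda>x. snd (snd x)) = rewards M s"
    using distr_distr[OF g measurable_snd, of ?S]
      distr_pair_snd[OF prob_space_measure_pmf R.prob_space_axioms, of "\<pi> s"]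
    by (simp add: snd comp_def)
  moreover have "distr (?S \<Otimes>\<^sub>M ?N) borel (\<lambda>x. snd (snd x)) =
      distr (?S \<Otimes>\<^sub>M ?N) (rewards M s) (\<lambda>x. snd (snd x))"
    by (rule distr_cong) (auto simp: sets_R)
  ultimately show "distr (step_law M \<pi> s) borel (\<lambda>x. snd (snd x)) = rewards M s"
    unfolding step_law_def by simp
qed

section \<open>The Markov chain of the states\<close>

definition next_state :: "('s, 'a) mdp \<Rightarrow> ('s \<Rightarrow> 'a pmf) \<Rightarrow> 's \<Rightarrow> 's pmf" where
  "next_state M \<pi> s = \<pi> s \<bind> trans M s"

primrec state_law :: "('s, 'a) mdp \<Rightarrow> ('s \<Rightarrow> 'a pmf) \<Rightarrow> 's \<Rightarrow> nat \<Rightarrow> 's pmf" where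
  "state_law M \<pi> s 0 = return_pmf s"
| "state_law M \<pi> s (Suc t) = state_law M \<pi> s t \<bind> next_state M \<pi>"

text \<open>Chapman-Kolmogorov. The recursion for \<open>state_law\<close> appends a step at the
  end, as the Ionescu-Tulcea construction does, whereas the Bellman equation conditions on the first
  step. Associativity of bind passes from one to the other.\<close>

lemma state_law_Suc_shift:
  "state_law M \<pi> s (Suc t) = next_state M \<pi> s \<bind> (\<lambda>s'. state_law M \<pi> s' t)"
proof (induction t)
  case 0
  show ?case by (simp add: bind_return_pmf bind_return_pmf')
next
  case (Suc t)
  then show ?case by (simp only: state_law.simps(2) bind_assoc_pmf)
qed

text \<open>The transition ignores the reward, and the state is almost surely \<open>s\<close>. So
  only the action marginal of the step matters, and averaging over it is exactly
  \<open>next_state\<close>.\<close>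

lemma step_law_bind_next:
  fixes M :: "('s::finite, 'a) mdp"
  assumes M: "mdp Rmax M"
  shows "step_law M \<pi> s \<bind> (\<lambda>x. measure_pmf (trans M (fst x) (fst (snd x))) \<bind> step_law M \<pi>) =
     measure_pmf (next_state M \<pi> s) \<bind> step_law M \<pi>"
proof -
  define g where "g s' a = measure_pmf (trans M s' a) \<bind> step_law M \<pi>" for s' a
  note law = measurable_step_law[OF M, of \<pi>]
  have g_space: "g s' a \<in> space (subprob_algebra step_space)" for s' a
    unfolding g_def using subprob_space.bind_in_space[OF measure_pmf.subprob_space_axioms law] .
  then have g_meas: "g s' \<in> measurable (count_space UNIV) (subprob_algebra step_space)" for s'
    by (auto simp: measurable_def)
  \<comment> \<open>The action type may be uncountable. Measurability in the action is free because
    it carries the discrete sigma-algebra; countability is used for the state only.\<close>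
  have g1: "(\<lambda>x :: 's \<times> 'a \<times> real. g s' (fst (snd x))) \<in> measurable step_space (subprob_algebra step_space)" for s'
    by (rule measurable_compose[OF measurable_step_components(2) g_meas])
  have g2: "(\<lambda>x :: 's \<times> 'a \<times> real. g (fst x) (fst (snd x))) \<in> measurable step_space (subprob_algebra step_space)"
    by (rule measurable_compose_countable[OF g1 measurable_step_components(1)])
  have cong: "measurable (step_law M \<pi> s) N = measurable step_space N" for N :: "'x measure"
    by (rule measurable_cong_sets[OF sets_step_law[OF M] refl])
  have "step_law M \<pi> s \<bind> (\<lambda>x. g (fst x) (fst (snd x))) = step_law M \<pi> s \<bind> (\<lambda>x. g s (fst (snd x)))"
    using g1 g2 AE_step_law_state[OF M, where \<pi>=\<pi> and s=s]
    by (intro bind_cong_AE) (auto simp: cong)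
  also have "\<dots> = distr (step_law M \<pi> s) (count_space UNIV) (\<lambda>x. fst (snd x)) \<bind> g s"
    using g_meas prob_space.not_empty[OF step_law_subprob(2)[OF M]]
    by (subst bind_distr[where K=step_space]) (auto simp: cong measurable_step_components)
  also have "\<dots> = measure_pmf (\<pi> s) \<bind> g s"
    by (simp add: distr_step_law_action[OF M])
  also have "\<dots> = measure_pmf (next_state M \<pi> s) \<bind> step_law M \<pi>"
    unfolding g_def next_state_def measure_pmf_bind
    by (rule bind_assoc[symmetric, where N="count_space UNIV" and R=step_space])
       (use law[of undefined] in \<open>auto simp: measure_pmf_in_subprob_algebra\<close>)
  finally show ?thesis by (simp add: g_def)
qed

text \<open>The step kernel looks only at the last entry of the history. By induction the law of
  each step is therefore determined by the law of the step before it, and the trajectory reduces to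
  the chain \<open>state_law\<close>.\<close>

lemma distr_trajectory_step:
  fixes M :: "('s::finite, 'a) mdp"
  assumes M: "mdp Rmax M"
  shows "distr (trajectory M \<pi> s) step_space (\<lambda>\<omega>. \<omega> t) = measure_pmf (state_law M \<pi> s t) \<bind> step_law M \<pi>"
proof -
  interpret IT: Ionescu_Tulcea "step_kernel M \<pi> s" "\<lambda>_. step_space"
    by (rule Ionescu_Tulcea_step_kernel[OF M])
  let ?u = "\<lambda>_. undefined"
  note law = measurable_step_law[OF M, of \<pi>]
  have "IT.C 0 t ?u \<bind> step_kernel M \<pi> s t = measure_pmf (state_law M \<pi> s t) \<bind> step_law M \<pi>"
  proof (induction t)
    case 0
    \<comment> \<open>The empty history \<open>\<lambda>_. undefined\<close> is the only point of
      the product over no coordinates, and \<open>IT.C 0 0\<close> is the point mass there.\<close>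
    have "IT.C 0 0 ?u \<bind> step_kernel M \<pi> s 0 = step_kernel M \<pi> s 0 ?u"
      using IT.P[of 0] by (simp add: bind_return)
    also have "\<dots> = measure_pmf (state_law M \<pi> s 0) \<bind> step_law M \<pi>"
      using law[of undefined] by (simp add: step_kernel_def return_pmf.rep_eq bind_return[where N=step_space])
    finally show ?case .
  next
    case (Suc t)
    let ?g = "\<lambda>x. measure_pmf (trans M (fst x) (fst (snd x))) \<bind> step_law M \<pi>"
    have ker: "step_kernel M \<pi> s (Suc t) = (\<lambda>h. ?g (h t))"
      by (auto simp: step_kernel_def fun_eq_iff split: prod.split)
    have sets_C: "sets (IT.C 0 (Suc t) ?u) = sets (Pi\<^sub>M {0..<Suc t} (\<lambda>_. step_space))"
      using IT.sets_C[of ?u 0 "Suc t"] by simp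
    have "?g \<in> measurable step_space (subprob_algebra step_space)"
    proof (rule measurable_compose_countable[where g=fst, OF _ measurable_step_components(1)])
      show "(\<lambda>x :: 's \<times> 'a \<times> real. measure_pmf (trans M s' (fst (snd x))) \<bind> step_law M \<pi>)
          \<in> measurable step_space (subprob_algebra step_space)" for s'
        by (rule measurable_compose[OF measurable_step_components(2)])
           (auto intro: subprob_space.bind_in_space[OF measure_pmf.subprob_space_axioms law])
    qed
    note g = this
    have "IT.C 0 (Suc t) ?u \<bind> step_kernel M \<pi> s (Suc t) =
        distr (IT.C 0 (Suc t) ?u) step_space (\<lambda>h. h t) \<bind> ?g"
      unfolding ker
    proof (rule bind_distr[symmetric, OF _ g])
      show "(\<lambda>h. h t) \<in> measurable (IT.C 0 (Suc t) ?u) step_space"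
        unfolding measurable_cong_sets[OF sets_C refl]
        by (rule measurable_component_singleton) simp
      show "space (IT.C 0 (Suc t) ?u) \<noteq> {}"
        by (rule prob_space.not_empty[OF IT.prob_space_C]) simp
    qed
    also have "\<dots> = (measure_pmf (state_law M \<pi> s t) \<bind> step_law M \<pi>) \<bind> ?g"
      by (simp only: IT.distr_C_last Suc.IH)
    also have "\<dots> = measure_pmf (state_law M \<pi> s t) \<bind> (\<lambda>s'. step_law M \<pi> s' \<bind> ?g)"
      by (rule bind_assoc[OF law g])
    also have "\<dots> = measure_pmf (state_law M \<pi> s t) \<bind>
        (\<lambda>s'. measure_pmf (next_state M \<pi> s') \<bind> step_law M \<pi>)"
      by (simp only: step_law_bind_next[OF M])
    also have "\<dots> = measure_pmf (state_law M \<pi> s (Suc t)) \<bind> step_law M \<pi>"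
      unfolding state_law.simps measure_pmf_bind
      by (rule bind_assoc[symmetric, where N="count_space UNIV" and R=step_space])
         (use law[of undefined] in \<open>auto simp: measure_pmf_in_subprob_algebra\<close>)
    finally show ?case .
  qed
  then show ?thesis
    unfolding trajectory_def by (simp only: IT.distr_lim_component)
qed

section \<open>Expected rewards and the Bellman equation\<close>

text \<open>A probability law cannot be concentrated on \<open>{- Rmax..Rmax}\<close> if that
  interval is empty.\<close>

lemma mdp_Rmax_nonneg:
  assumes "mdp Rmax M"
  shows "0 \<le> Rmax"
proof -
  interpret prob_space "rewards M s" for s
    using assms by (simp add: mdp_def)
  have "AE r in rewards M s. r \<in> {- Rmax..Rmax}" for s
    using assms by (simp add: mdp_def)
  then have "AE r in rewards M s. 0 \<le> Rmax" for s
    by (rule AE_mp) (auto intro!: AE_I2)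
  then show ?thesis by simp
qed

definition mean_reward :: "('s, 'a) mdp \<Rightarrow> 's \<Rightarrow> real" where
  "mean_reward M s = (\<integral>r. r \<partial>rewards M s)"

lemma abs_mean_reward_le:
  assumes M: "mdp Rmax M"
  shows "\<bar>mean_reward M s\<bar> \<le> Rmax"
proof -
  interpret prob_space "rewards M s"
    using assms by (simp add: mdp_def)
  have ae: "AE r in rewards M s. - Rmax \<le> r" "AE r in rewards M s. r \<le> Rmax"
    using M by (auto simp: mdp_def)
  have "(\<lambda>r. r) \<in> borel_measurable (rewards M s)"
    using M by (simp add: mdp_def measurable_ident_sets)
  then have "integrable (rewards M s) (\<lambda>r. r)"
    using ae by (intro integrable_const_bound[where B=Rmax]) auto
  from integral_le_const[OF this ae(2)] integral_ge_const[OF this ae(1)] show ?thesis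
    unfolding mean_reward_def by (simp add: abs_le_iff)
qed

lemma
  fixes M :: "('s::finite, 'a) mdp"
  assumes M: "mdp Rmax M"
  shows measurable_reward_at: "reward_at t \<in> borel_measurable (trajectory M \<pi> s)"
    and prob_space_trajectory: "prob_space (trajectory M \<pi> s)"
    and distr_reward_at:
      "distr (trajectory M \<pi> s) borel (reward_at t) = measure_pmf (state_law M \<pi> s t) \<bind> rewards M"
proof -
  interpret IT: Ionescu_Tulcea "step_kernel M \<pi> s" "\<lambda>_. step_space"
    by (rule Ionescu_Tulcea_step_kernel[OF M])
  note law = measurable_step_law[OF M, of \<pi>]
  have sets_traj: "sets (trajectory M \<pi> s) = sets (Pi\<^sub>M UNIV (\<lambda>_. step_space))"
    by (simp add: trajectory_def)
  have component: "(\<lambda>\<omega>. \<omega> t) \<in> measurable (trajectory M \<pi> s) step_space" for t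
    unfolding measurable_cong_sets[OF sets_traj refl] by simp
  have reward: "reward_at t = (\<lambda>x. snd (snd x)) \<circ> (\<lambda>\<omega>. \<omega> t)"
    by (auto simp: reward_at_def)
  show "reward_at t \<in> borel_measurable (trajectory M \<pi> s)"
    unfolding reward using component measurable_step_components(3) by (rule measurable_comp)
  \<comment> \<open>An image measure has the same total mass as its source, so it suffices to see
    that the law of step 0 is a probability measure.\<close>
  have "prob_space (measure_pmf (state_law M \<pi> s 0) \<bind> step_law M \<pi>)"
    using step_law_subprob(2)[OF M]
    by (intro prob_space.prob_space_bind[OF prob_space_measure_pmf _ law]) auto
  then show "prob_space (trajectory M \<pi> s)"
    using distr_trajectory_step[OF M, of \<pi> s 0] component prob_space_distrD by metis
  have "distr (trajectory M \<pi> s) borel (reward_at t) =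
      distr (measure_pmf (state_law M \<pi> s t) \<bind> step_law M \<pi>) borel (\<lambda>x. snd (snd x))"
    unfolding reward distr_trajectory_step[OF M, symmetric]
    by (rule distr_distr[symmetric, OF measurable_step_components(3) component])
  also have "\<dots> = measure_pmf (state_law M \<pi> s t) \<bind> rewards M"
    by (simp add: distr_bind[OF law _ measurable_step_components(3)] distr_step_law_reward[OF M])
  finally show "distr (trajectory M \<pi> s) borel (reward_at t) = measure_pmf (state_law M \<pi> s t) \<bind> rewards M" .
qed

lemma
  fixes M :: "('s::finite, 'a) mdp"
  assumes M: "mdp Rmax M"
  shows AE_reward_at: "AE \<omega> in trajectory M \<pi> s. \<bar>reward_at t \<omega>\<bar> \<le> Rmax"
    and integral_reward_at: "(\<integral>\<omega>. reward_at t \<omega> \<partial>trajectory M \<pi> s) =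
      measure_pmf.expectation (state_law M \<pi> s t) (mean_reward M)"
proof -
  let ?T = "trajectory M \<pi> s" and ?p = "measure_pmf (state_law M \<pi> s t)"
  have rew: "prob_space (rewards M s)" "sets (rewards M s) = sets borel"
    "AE r in rewards M s. \<bar>r\<bar> \<le> Rmax" for s
    using M by (auto simp: mdp_def abs_le_iff minus_le_iff)
  have kernel: "rewards M \<in> measurable ?p (subprob_algebra borel)"
    using rew by (auto simp: measurable_def space_subprob_algebra prob_space_imp_subprob_space)
  have "AE r in ?p \<bind> rewards M. \<bar>r\<bar> \<le> Rmax"
    using rew(3) by (subst AE_bind[OF kernel]) auto
  then have ae: "AE r in distr ?T borel (reward_at t). \<bar>r\<bar> \<le> Rmax"
    by (simp only: distr_reward_at[OF M])
  then show "AE \<omega> in ?T. \<bar>reward_at t \<omega>\<bar> \<le> Rmax"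
    by (rule AE_distrD[OF measurable_reward_at[OF M]])
  \<comment> \<open>\<open>integral_bind\<close> asks for a function that is bounded everywhere, not just almost everywhere.\<close>
  define clip where "clip r = max (- Rmax) (min Rmax r)" for r :: real
  have clip: "clip \<in> borel_measurable borel" "\<bar>clip r\<bar> \<le> Rmax" "\<bar>r\<bar> \<le> Rmax \<Longrightarrow> clip r = r" for r
    using mdp_Rmax_nonneg[OF M] by (auto simp: clip_def[abs_def])
  have "(\<integral>\<omega>. reward_at t \<omega> \<partial>?T) = (\<integral>r. r \<partial>distr ?T borel (reward_at t))"
    by (subst integral_distr[OF measurable_reward_at[OF M]]) auto
  also have "\<dots> = (\<integral>r. clip r \<partial>distr ?T borel (reward_at t))"
    using ae clip by (intro integral_cong_AE) (auto elim!: AE_mp)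
  also have "\<dots> = (\<integral>s'. \<integral>r. clip r \<partial>rewards M s' \<partial>?p)"
    unfolding distr_reward_at[OF M]
    using clip(2) prob_space.emeasure_space_1[OF rew(1)]
    by (intro integral_bind[OF clip(1) _ kernel measure_pmf.finite_measure_axioms, of Rmax 1]) auto
  also have "\<dots> = measure_pmf.expectation (state_law M \<pi> s t) (mean_reward M)"
  proof (rule Bochner_Integration.integral_cong[OF refl])
    fix s'
    show "(\<integral>r. clip r \<partial>rewards M s') = mean_reward M s'"
      unfolding mean_reward_def using rew(2,3)[of s'] clip
      by (intro integral_cong_AE) (auto elim!: AE_mp cong: measurable_cong_sets)
  qed
  finally show "(\<integral>\<omega>. reward_at t \<omega> \<partial>?T) = measure_pmf.expectation (state_law M \<pi> s t) (mean_reward M)" .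
qed

lemma expectation_pmf_finite:
  fixes p :: "'s::finite pmf" and h :: "'s \<Rightarrow> real"
  shows "measure_pmf.expectation p h = (\<Sum>s\<in>UNIV. pmf p s * h s)"
  by (subst integral_measure_pmf[of UNIV]) auto

lemma abs_expectation_pmf_le:
  fixes p :: "'s::finite pmf" and h :: "'s \<Rightarrow> real"
  assumes "\<And>s. \<bar>h s\<bar> \<le> B"
  shows "\<bar>measure_pmf.expectation p h\<bar> \<le> B"
proof -
  have "\<bar>measure_pmf.expectation p h\<bar> \<le> measure_pmf.expectation p (\<lambda>s. \<bar>h s\<bar>)"
    by (rule integral_abs_bound)
  also have "\<dots> \<le> measure_pmf.expectation p (\<lambda>_. B)"
    using assms by (intro integral_mono integrable_measure_pmf_finite) auto
  finally show ?thesis by simp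
qed

section \<open>Discounted series and policy evaluation\<close>

context
  fixes M :: "('s::finite, 'a) mdp" and Rmax :: real
  assumes M: "mdp Rmax M"
begin

lemma discount_bounds: "0 \<le> discount M" "discount M < 1"
  using M by (auto simp: mdp_def)

lemma summable_discounted:
  assumes "\<And>t. \<bar>f t\<bar> \<le> Rmax"
  shows "summable (\<lambda>t. \<bar>discount M ^ t * f t\<bar>)"
proof (rule summable_comparison_test')
  show "summable (\<lambda>t. discount M ^ t * Rmax)"
    using discount_bounds by (intro summable_mult2 summable_geometric) auto
  show "norm \<bar>discount M ^ t * f t\<bar> \<le> discount M ^ t * Rmax" for t
    using discount_bounds assms[of t] by (auto simp: abs_mult intro!: mult_left_mono)
qed

text \<open>Expectation and series are interchanged, with a geometric series as dominating bound.
  \<open>summable_discounted\<close> serves twice: for the expected absolute rewards, and for almost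
  every trajectory, since countably many null sets can be discarded at once.\<close>

lemma state_value_sums:
  "(\<lambda>t. discount M ^ t * measure_pmf.expectation (state_law M \<pi> s t) (mean_reward M)) sums state_value M \<pi> s"
proof -
  let ?T = "trajectory M \<pi> s"
  interpret prob_space ?T by (rule prob_space_trajectory[OF M])
  note AE_reward = AE_reward_at[OF M, where \<pi>=\<pi> and s=s]
  have int: "integrable ?T (reward_at t)" for t
    using AE_reward by (intro integrable_const_bound measurable_reward_at[OF M]) auto
  have "\<bar>\<integral>\<omega>. \<bar>reward_at t \<omega>\<bar> \<partial>?T\<bar> \<le> Rmax" for t
  proof -
    have "(\<integral>\<omega>. \<bar>reward_at t \<omega>\<bar> \<partial>?T) \<le> (\<integral>\<omega>. Rmax \<partial>?T)"
      using int AE_reward by (intro integral_mono_AE) auto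
    then show ?thesis by (simp add: prob_space)
  qed
  from summable_discounted[OF this]
  have "summable (\<lambda>t. \<integral>\<omega>. norm (discount M ^ t * reward_at t \<omega>) \<partial>?T)"
    using discount_bounds by (simp add: abs_mult)
  moreover have "AE \<omega> in ?T. summable (\<lambda>t. norm (discount M ^ t * reward_at t \<omega>))"
  proof -
    have "AE \<omega> in ?T. \<forall>t. \<bar>reward_at t \<omega>\<bar> \<le> Rmax"
      using AE_reward by (simp add: AE_all_countable)
    then show ?thesis
      using summable_discounted by (auto elim!: AE_mp)
  qed
  ultimately have "(\<lambda>t. \<integral>\<omega>. discount M ^ t * reward_at t \<omega> \<partial>?T) sums state_value M \<pi> s"
    unfolding state_value_def using int by (intro sums_integral) auto
  then show ?thesis
    by (simp add: integral_reward_at[OF M])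
qed

lemma abs_state_value_le: "\<bar>state_value M \<pi> s\<bar> \<le> Rmax / (1 - discount M)"
proof -
  let ?f = "\<lambda>t. measure_pmf.expectation (state_law M \<pi> s t) (mean_reward M)"
  have f: "\<bar>?f t\<bar> \<le> Rmax" for t
    using abs_mean_reward_le[OF M] by (rule abs_expectation_pmf_le)
  have geo: "(\<lambda>t. discount M ^ t * Rmax) sums (1 / (1 - discount M) * Rmax)"
    using discount_bounds by (intro sums_mult2 geometric_sums) auto
  have "\<bar>state_value M \<pi> s\<bar> \<le> (\<Sum>t. \<bar>discount M ^ t * ?f t\<bar>)"
    using summable_rabs[OF summable_discounted[of ?f, OF f]] state_value_sums[of \<pi> s]
    by (simp add: sums_iff)
  also have "\<dots> \<le> (\<Sum>t. discount M ^ t * Rmax)"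
    using discount_bounds f summable_discounted[of ?f, OF f] geo
    by (intro suminf_le) (auto simp: abs_mult sums_iff intro!: mult_left_mono)
  also have "\<dots> = Rmax / (1 - discount M)"
    using geo by (simp add: sums_iff)
  finally show ?thesis .
qed

text \<open>In the series for the value, the term at time 0 is the mean reward in \<open>s\<close>.
  The tail is rewritten by conditioning on the first step; as there are finitely many states, the
  sum over them commutes with the series.\<close>

lemma state_value_Bellman:
  "state_value M \<pi> s =
     mean_reward M s + discount M * measure_pmf.expectation (next_state M \<pi> s) (state_value M \<pi>)"
proof -
  let ?E = "\<lambda>s t. measure_pmf.expectation (state_law M \<pi> s t) (mean_reward M)"
  have shift: "?E s (Suc t) = (\<Sum>s'\<in>UNIV. pmf (next_state M \<pi> s) s' * ?E s' t)" for t
    unfolding state_law_Suc_shift by (subst pmf_expectation_bind[of UNIV]) auto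
  have "(\<lambda>t. discount M * (\<Sum>s'\<in>UNIV. pmf (next_state M \<pi> s) s' * (discount M ^ t * ?E s' t)))
      sums (discount M * (\<Sum>s'\<in>UNIV. pmf (next_state M \<pi> s) s' * state_value M \<pi> s'))"
    by (intro sums_mult sums_sum state_value_sums)
  moreover have "discount M * (\<Sum>s'\<in>UNIV. pmf (next_state M \<pi> s) s' * (discount M ^ t * ?E s' t)) =
      discount M ^ Suc t * ?E s (Suc t)" for t
    unfolding shift by (simp add: sum_distrib_left mult_ac)
  ultimately have "(\<lambda>t. discount M ^ Suc t * ?E s (Suc t)) sums
      (discount M * measure_pmf.expectation (next_state M \<pi> s) (state_value M \<pi>))"
    unfolding expectation_pmf_finite[of _ "state_value M \<pi>"] by simp
  then have "(\<lambda>t. discount M ^ t * ?E s t) sums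
      (discount M * measure_pmf.expectation (next_state M \<pi> s) (state_value M \<pi>) + mean_reward M s)"
    by (subst (asm) sums_Suc_iff) simp
  with state_value_sums[of \<pi> s] show ?thesis
    by (auto dest: sums_unique2)
qed

end

lemma expectation_next_state:
  fixes M :: "('s::finite, 'a) mdp" and h :: "'s \<Rightarrow> real"
  shows "measure_pmf.expectation (next_state M \<pi> s) h =
    measure_pmf.expectation (\<pi> s) (\<lambda>a. measure_pmf.expectation (trans M s a) h)"
proof -
  \<comment> \<open>The action law may have infinite support, so the nested expectation is treated
    as an integral. \<open>integral_bind\<close> needs a uniform bound on \<open>h\<close>, and over
    finitely many states this sum is one.\<close>
  have "\<bar>h s\<bar> \<le> (\<Sum>s\<in>UNIV. \<bar>h s\<bar>)" for s
    by (rule member_le_sum) auto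
  then show ?thesis
    unfolding next_state_def measure_pmf_bind
    by (intro integral_bind[where K="count_space UNIV" and B'=1])
       (auto simp: measure_pmf.finite_measure_axioms measure_pmf_in_subprob_algebra)
qed

section \<open>Imitating a policy\<close>

text \<open>Hoelder's inequality for the L1 and the supremum norm. It turns closeness of transition
  laws into closeness of expected values.\<close>

lemma expectation_diff_le_l1_dist:
  fixes p q :: "'s::finite pmf" and h :: "'s \<Rightarrow> real"
  assumes "\<And>s. \<bar>h s\<bar> \<le> B"
  shows "measure_pmf.expectation p h - measure_pmf.expectation q h \<le> l1_dist_pmf p q * B"
proof -
  have "measure_pmf.expectation p h - measure_pmf.expectation q h = (\<Sum>s\<in>UNIV. (pmf p s - pmf q s) * h s)"
    by (simp add: expectation_pmf_finite sum_subtractf left_diff_distrib)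
  also have "\<dots> \<le> (\<Sum>s\<in>UNIV. \<bar>pmf p s - pmf q s\<bar> * B)"
  proof (rule sum_mono)
    fix s
    have "(pmf p s - pmf q s) * h s \<le> \<bar>pmf p s - pmf q s\<bar> * \<bar>h s\<bar>"
      by (metis abs_ge_self abs_mult)
    also have "\<dots> \<le> \<bar>pmf p s - pmf q s\<bar> * B"
      using assms by (intro mult_left_mono) auto
    finally show "(pmf p s - pmf q s) * h s \<le> \<bar>pmf p s - pmf q s\<bar> * B" .
  qed
  finally show ?thesis
    by (simp add: l1_dist_pmf_def sum_distrib_right)
qed

text \<open>Structures and available actions are kept out of the statement: any replacement
  \<open>f\<close> with error \<epsilon> will do. This lets the theorem apply it both with an error
  from the Lipschitz condition and with a trivial one.\<close>

lemma state_value_imitation: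
  fixes M :: "('s::finite, 'a) mdp"
  assumes M: "mdp Rmax M"
    and f: "\<And>s a. a \<in> set_pmf (\<mu> s) \<Longrightarrow> l1_dist_pmf (trans M s a) (trans M s (f s a)) \<le> \<epsilon>"
  shows "state_value M \<mu> s - state_value M (\<lambda>s. map_pmf (f s) (\<mu> s)) s
    \<le> discount M * \<epsilon> / (1 - discount M)\<^sup>2 * Rmax"
proof -
  define V where "V = state_value M \<mu>"
  define W where "W = state_value M (\<lambda>s. map_pmf (f s) (\<mu> s))"
  define B where "B = Rmax / (1 - discount M)"
  \<comment> \<open>The signed difference suffices, since only an upper bound is sought. Its maximum
    is attained because the state type is finite.\<close>
  define D where "D = Max (range (\<lambda>s. V s - W s))"
  note \<gamma> = discount_bounds[OF M]
  have B: "0 \<le> B"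
    using \<gamma> mdp_Rmax_nonneg[OF M] by (simp add: B_def)
  have V: "\<bar>V s\<bar> \<le> B" and W: "\<bar>W s\<bar> \<le> B" for s
    unfolding V_def W_def B_def by (rule abs_state_value_le[OF M])+
  have D: "V s - W s \<le> D" for s
    unfolding D_def by (rule Max_ge) auto
  have step: "V s - W s \<le> discount M * (\<epsilon> * B + D)" for s
  proof -
    let ?EV = "\<lambda>a. measure_pmf.expectation (trans M s a) V"
    let ?EW = "\<lambda>a. measure_pmf.expectation (trans M s (f s a)) W"
    have int: "integrable (\<mu> s) ?EV" "integrable (\<mu> s) ?EW"
      using abs_expectation_pmf_le[of V, OF V] abs_expectation_pmf_le[of W, OF W]
      by (auto intro!: measure_pmf.integrable_const_bound[where B=B])
    \<comment> \<open>The expectation of \<open>V\<close> under the law of the replacement action is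
      inserted in between. First the law changes with \<open>V\<close> fixed, then the value
      function changes with the law fixed.\<close>
    have "?EV a - ?EW a \<le> \<epsilon> * B + D" if "a \<in> set_pmf (\<mu> s)" for a
    proof -
      let ?q = "trans M s (f s a)"
      have "?EV a - measure_pmf.expectation ?q V \<le> l1_dist_pmf (trans M s a) ?q * B"
        using V by (rule expectation_diff_le_l1_dist)
      also have "\<dots> \<le> \<epsilon> * B"
        using f[OF that] B by (rule mult_right_mono)
      finally have "?EV a - measure_pmf.expectation ?q V \<le> \<epsilon> * B" .
      moreover have "measure_pmf.expectation ?q V - measure_pmf.expectation ?q W \<le> D"
      proof -
        have "measure_pmf.expectation ?q V - measure_pmf.expectation ?q W = measure_pmf.expectation ?q (\<lambda>s. V s - W s)"
          by (subst Bochner_Integration.integral_diff) (auto intro: integrable_measure_pmf_finite)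
        also have "\<dots> \<le> measure_pmf.expectation ?q (\<lambda>_. D)"
          using D by (intro integral_mono integrable_measure_pmf_finite) auto
        finally show ?thesis by simp
      qed
      ultimately show ?thesis by simp
    qed
    then have "measure_pmf.expectation (\<mu> s) (\<lambda>a. ?EV a - ?EW a) \<le>
        measure_pmf.expectation (\<mu> s) (\<lambda>_. \<epsilon> * B + D)"
      using int by (intro integral_mono_AE) (auto simp: AE_measure_pmf_iff)
    then have "measure_pmf.expectation (\<mu> s) ?EV - measure_pmf.expectation (\<mu> s) ?EW \<le> \<epsilon> * B + D"
      using int by simp
    \<comment> \<open>Rewards depend on the state alone, so the mean rewards cancel although the two
      policies play different actions.\<close>
    moreover have "V s - W s =
        discount M * (measure_pmf.expectation (\<mu> s) ?EV - measure_pmf.expectation (\<mu> s) ?EW)"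
      using state_value_Bellman[OF M, of \<mu> s]
        state_value_Bellman[OF M, of "\<lambda>s. map_pmf (f s) (\<mu> s)" s]
      by (simp add: expectation_next_state V_def W_def right_diff_distrib)
    ultimately show ?thesis
      using \<gamma> by (simp add: mult_left_mono)
  qed
  have "D \<in> range (\<lambda>s. V s - W s)"
    unfolding D_def by (rule Max_in) auto
  then have "D \<le> discount M * (\<epsilon> * B + D)"
    using step by auto
  then have "D * (1 - discount M) \<le> discount M * \<epsilon> * B"
    by (simp add: algebra_simps)
  \<comment> \<open>Solving for \<open>D\<close> contributes one factor
    \<open>1 / (1 - discount M)\<close>; the other one sits in \<open>B\<close>.\<close>
  then have "D \<le> discount M * \<epsilon> * B / (1 - discount M)"
    using \<gamma> by (simp add: pos_le_divide_eq)
  with D[of s] show ?thesis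
    by (simp add: V_def W_def B_def power2_eq_square)
qed

text \<open>With error 2 every action imitates every other one, which gives a finite bound even when
  the gap is infinite.\<close>

lemma l1_dist_pmf_le_2: "l1_dist_pmf p q \<le> 2"
proof -
  have "l1_dist_pmf p q \<le> (\<Sum>s\<in>UNIV. pmf p s + pmf q s)"
    unfolding l1_dist_pmf_def
    by (intro sum_mono) (metis abs_triangle_ineq4 abs_of_nonneg pmf_nonneg)
  also have "\<dots> = 2"
    by (simp add: sum.distrib sum_pmf_eq_1)
  finally show ?thesis .
qed

lemma state_value_actions_update [simp]: "state_value (M\<lparr>actions := A\<rparr>) \<pi> s = state_value M \<pi> s"
proof -
  have "step_law (M\<lparr>actions := A\<rparr>) = step_law M"
    by (intro ext) (simp add: step_law_def)
  then have "step_kernel (M\<lparr>actions := A\<rparr>) = step_kernel M"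
    by (intro ext) (simp add: step_kernel_def split: nat.split prod.split)
  then show ?thesis
    by (simp add: state_value_def trajectory_def)
qed

lemma mdp_at_eq: "mdp_at L u k = base L\<lparr>actions := actions (base L) \<union> observe L ` (\<Union>j\<in>{1..k}. u j)\<rparr>"
  by (induction k) (simp_all add: atLeastAtMostSuc_conv image_Un Un_ac)

lemma l1_norm_nonneg: "0 \<le> l1_norm x"
  by (simp add: l1_norm_def sum_nonneg)

theorem theorem1:
  fixes L :: "('s::finite, 'a, 'd::finite) lmdp"
    and Rmax \<rho> :: real
    and k :: nat
    and \<tau> :: "nat \<Rightarrow> nat"
    and u :: "nat \<Rightarrow> (real ^ 'd) set"
    and \<pi> \<mu> :: "'s \<Rightarrow> 'a pmf"
    and s0 :: 's
  assumes "lmdp Rmax L"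
    and "lipschitz_trans \<rho> L"
    and "changes L k \<tau> u"
    and "optimal_policy (mdp_at L u k) \<pi>"
    and "optimal_policy (full_mdp L) \<mu>"
    and "s0 \<in> set_pmf (init (base L))"
  shows "ereal (state_value (full_mdp L) \<mu> s0 - state_value (mdp_at L u k) \<pi> s0)
    \<le> ereal (discount (base L) * \<rho>) * action_gap L (mdp_at L u k)
        / ereal ((1 - discount (base L))\<^sup>2) * ereal Rmax"
proof -
  let ?M = "mdp_at L u k" and ?\<gamma> = "discount (base L)"
  define X where "X = state_value (base L) \<mu> s0 - state_value (base L) \<pi> s0"
  have M: "mdp Rmax (base L)" and base: "actions (base L) = {}"
    using assms(1) by (auto simp: lmdp_def)
  note \<gamma> = discount_bounds[OF M] and Rmax = mdp_Rmax_nonneg[OF M]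
  have \<rho>: "0 < \<rho>"
    and lip: "\<And>s e e'. e \<in> structs L \<Longrightarrow> e' \<in> structs L \<Longrightarrow>
      l1_dist_pmf (trans (base L) s (observe L e)) (trans (base L) s (observe L e')) \<le> \<rho> * l1_norm (e - e')"
    using assms(2) by (auto simp: lipschitz_trans_def struct_trans_def)
  have "u j \<subseteq> structs L" if "j \<in> {1..k}" for j
    using assms(1,3) that unfolding changes_def lmdp_def by blast
  then have actions_sub: "actions ?M \<subseteq> observe L ` structs L"
    unfolding mdp_at_eq base by fastforce
  have \<pi>: "set_pmf (\<pi> s) \<subseteq> actions ?M" for s
    using assms(4) by (simp add: optimal_policy_def policies_def)
  have \<mu>: "set_pmf (\<mu> s) \<subseteq> observe L ` structs L" for s
    using assms(5) by (simp add: optimal_policy_def policies_def full_mdp_def)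
  \<comment> \<open>A policy has nonempty support in every state, so an action is available. Its
    structure \<open>e0\<close> keeps the outer supremum of the gap from being the empty one, which
    would be minus infinity.\<close>
  obtain a0 where a0: "a0 \<in> actions ?M"
    using \<pi>[of s0] set_pmf_not_empty[of "\<pi> s0"] by auto
  then obtain e0 where e0: "e0 \<in> structs L"
    using actions_sub by auto

  \<comment> \<open>This reduces the theorem to finding, for each possible action, an available one
    that is \<epsilon>-close in all states at once. The resulting imitator is a policy of
    \<open>?M\<close>, so optimality of \<pi> bounds its value.\<close>
  have X_le: "X \<le> ?\<gamma> * \<epsilon> / (1 - ?\<gamma>)\<^sup>2 * Rmax"
    if "\<And>a. a \<in> observe L ` structs L \<Longrightarrow>
      \<exists>a'\<in>actions ?M. \<forall>s. l1_dist_pmf (trans (base L) s a) (trans (base L) s a') \<le> \<epsilon>" for \<epsilon>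
  proof -
    from that obtain f where f: "\<And>a. a \<in> observe L ` structs L \<Longrightarrow> f a \<in> actions ?M"
      "\<And>a s. a \<in> observe L ` structs L \<Longrightarrow> l1_dist_pmf (trans (base L) s a) (trans (base L) s (f a)) \<le> \<epsilon>"
      by metis
    have "(\<lambda>s. map_pmf f (\<mu> s)) \<in> policies ?M"
      using f(1) \<mu> by (fastforce simp: policies_def)
    then have "state_value ?M (\<lambda>s. map_pmf f (\<mu> s)) s0 \<le> state_value ?M \<pi> s0"
      using assms(4) by (simp add: optimal_policy_def)
    moreover have "state_value (base L) \<mu> s0 - state_value (base L) (\<lambda>s. map_pmf f (\<mu> s)) s0
        \<le> ?\<gamma> * \<epsilon> / (1 - ?\<gamma>)\<^sup>2 * Rmax"
      using f(2) \<mu> by (intro state_value_imitation[OF M, where f="\<lambda>_. f"]) blast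
    ultimately show ?thesis
      by (simp add: X_def mdp_at_eq)
  qed

  have gap: "action_gap L ?M =
      (SUP e\<in>structs L. INF e'\<in>structs_of L (actions ?M). ereal (l1_norm (e - e')))"
  proof -
    have "structs_of L (actions (full_mdp L)) = structs L"
      by (auto simp: structs_of_def full_mdp_def)
    then show ?thesis
      by (simp add: action_gap_def)
  qed
  have gap_nonneg: "0 \<le> action_gap L ?M"
    unfolding gap by (rule SUP_upper2[OF e0]) (auto intro!: INF_greatest simp: l1_norm_nonneg)
  have "ereal X \<le> ereal (?\<gamma> * \<rho>) * action_gap L ?M / ereal ((1 - ?\<gamma>)\<^sup>2) * ereal Rmax"
  proof (cases "action_gap L ?M")
    case (real g)
    define c where "c = ?\<gamma> * \<rho> / (1 - ?\<gamma>)\<^sup>2 * Rmax"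
    \<comment> \<open>The slack \<open>\<delta>\<close> is needed because the infimum in the gap need not be attained.\<close>
    have "X \<le> c * (g + \<delta>)" if "0 < \<delta>" for \<delta>
    proof -
      have "X \<le> ?\<gamma> * (\<rho> * (g + \<delta>)) / (1 - ?\<gamma>)\<^sup>2 * Rmax"
      proof (rule X_le)
        fix a assume "a \<in> observe L ` structs L"
        then obtain e where e: "e \<in> structs L" "a = observe L e" by auto
        have "(INF e'\<in>structs_of L (actions ?M). ereal (l1_norm (e - e'))) \<le> action_gap L ?M"
          unfolding gap using e(1) by (rule SUP_upper)
        also have "\<dots> = ereal g"
          by (rule real)
        also have "\<dots> < ereal (g + \<delta>)"
          using \<open>0 < \<delta>\<close> by simp
        \<comment> \<open>\<open>observe\<close> need not be injective, so \<open>e'\<close> itself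
          may never have been added. It is enough that its action is available, since transitions
          depend on a structure only through its action.\<close>
        finally obtain e' where e': "e' \<in> structs_of L (actions ?M)" "l1_norm (e - e') < g + \<delta>"
          by (auto simp: INF_less_iff)
        have "l1_dist_pmf (trans (base L) s a) (trans (base L) s (observe L e')) \<le> \<rho> * (g + \<delta>)" for s
        proof -
          have "\<rho> * l1_norm (e - e') \<le> \<rho> * (g + \<delta>)"
            using \<rho> e'(2) by simp
          then show ?thesis
            using lip[of e e' s] e e'(1) by (simp add: structs_of_def)
        qed
        then show "\<exists>a'\<in>actions ?M. \<forall>s. l1_dist_pmf (trans (base L) s a) (trans (base L) s a') \<le> \<rho> * (g + \<delta>)"
          using e'(1) by (auto simp: structs_of_def)
      qed
      then show ?thesis by (simp add: c_def mult_ac)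
    qed
    then have lim: "\<forall>\<^sub>F \<delta> in at_right 0. X \<le> c * (g + \<delta>)"
      by (rule eventually_mono[OF eventually_at_right_less])
    have "((\<lambda>\<delta>. c * (g + \<delta>)) \<longlongrightarrow> c * (g + 0)) (at_right 0)"
      by (intro tendsto_intros)
    from tendsto_lowerbound[OF this lim] have "X \<le> c * g" by simp
    then show ?thesis
      using \<gamma> by (simp add: real c_def mult_ac)
  next
    case PInf
    \<comment> \<open>Since \<open>0 * \<infinity> = 0\<close>, the bound still says something when \<open>\<gamma> = 0\<close> or \<open>Rmax = 0\<close>.\<close>
    have "X \<le> ?\<gamma> * 2 / (1 - ?\<gamma>)\<^sup>2 * Rmax"
      by (intro X_le bexI[OF _ a0] allI l1_dist_pmf_le_2)
    then have "X \<le> 0" if "?\<gamma> = 0 \<or> Rmax = 0"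
      using that by auto
    moreover have "ereal (?\<gamma> * \<rho>) * \<infinity> / ereal ((1 - ?\<gamma>)\<^sup>2) * ereal Rmax =
        (if ?\<gamma> = 0 \<or> Rmax = 0 then 0 else \<infinity>)"
      using \<gamma> \<rho> Rmax by (auto simp: ereal_divide_eq zero_less_mult_iff)
    ultimately show ?thesis
      by (simp add: PInf)
  next
    case MInf
    then show ?thesis
      using gap_nonneg by simp
  qed
  then show ?thesis
    by (simp add: X_def mdp_at_eq full_mdp_def)
qed

end
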